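(* Let $S=K_1\cup K_2$ be the vertex disjoint union of two cliques (contained in $V_d$ for some $d$), where $K_1$ has weight $a_1$ and order $a_1+t_1$ and $K_2$ has weight $a_2$ and order $a_2+t_2$, with $a_1=p_12^{r_1}$ and $a_2=p_22^{r_2}$, where $t_1,t_2,r_1,r_2\ge 0$ are integers, $p_1,p_2$ are odd (positive) integers, and $r_1\le r_2$. Then $S$ is $2$-Ramsey if and only if at least one of the following is satisfied: (1) $r_1=r_2$; (2) at least one of $t_1$ or $t_2$ is equal to $0$, and $a_1$ and $a_2$ are both even; (3) $t_1$ or $t_2$ is equal to $1$, and $2\le r_1<r_2$.
   Context: For $d\ge1$, $[d]=\{1,\dots,d\}$ and $V_d=2^{[d]}$ (the set of all subsets of $[d]$) is the vertex set of the $d$-dimensional hypercube $Q_d$; two sets are adjacent iff their symmetric difference has exactly one element. For $1\le d\le n$, an embedding of $Q_d$ into $Q_n$ is an injective map $\psi:V_d\to V_n$ sending adjacent pairs to adjacent pairs. For $F\subseteq V_d$ and $T\subseteq V_n$, $T$ contains a copy of $F$ if some embedding $\psi:V_d\to V_n$ satisfies $\psi(F)\subseteq T$. A $t$-coloring of $Q_n$ is a map $c:V_n\to[t]$; it contains a monochromatic copy of $F$ if some color class $c^{-1}(i)$ contains a copy of $F$. A set $F\subseteq V_d$ is $t$-Ramsey if there is $n_0$ such that for all $n\ge n_0$ every $t$-coloring of $Q_n$ contains a monochromatic copy of $F$. A clique of weight $a$ and order $k$ is a family $K^{(a)}$ consisting of all $a$-element subsets of a set $K$ with $|K|=k$; $K$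 is called its vertex set. A union of cliques is vertex disjoint if the vertex sets of distinct cliques are pairwise disjoint. *)

theory Defs
  imports Complex_Main "HOL-Library.Ramsey"
begin

definition cube_verts :: "nat \<Rightarrow> nat set set" where
  "cube_verts d = Pow {1..d}"

definition cube_adj :: "nat set \<Rightarrow> nat set \<Rightarrow> bool" where
  "cube_adj A B \<longleftrightarrow> card (sym_diff A B) = 1"

definition cube_embedding :: "nat \<Rightarrow> nat \<Rightarrow> (nat set \<Rightarrow> nat set) \<Rightarrow> bool" where
  "cube_embedding d n \<psi> \<longleftrightarrow>
     1 \<le> d \<and> d \<le> n \<and>
     \<psi> \<in> cube_verts d \<rightarrow> cube_verts n \<and>
     inj_on \<psi> (cube_verts d) \<and>
     (\<forall>A \<in> cube_verts d. \<forall>B \<in> cube_verts d. cube_adj A B \<longrightarrow> cube_adj (\<psi> A) (\<psi> B))"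

definition contains_copy :: "nat \<Rightarrow> nat \<Rightarrow> nat set set \<Rightarrow> nat set set \<Rightarrow> bool" where
  "contains_copy d n T F \<longleftrightarrow> (\<exists>\<psi>. cube_embedding d n \<psi> \<and> \<psi> ` F \<subseteq> T)"

text \<open>Colorings are functions on all of \<^typ>\<open>nat set\<close>; only their values on the vertices of
  the cube are constrained or used.\<close>

definition cube_coloring :: "nat \<Rightarrow> nat \<Rightarrow> (nat set \<Rightarrow> nat) \<Rightarrow> bool" where
  "cube_coloring t n c \<longleftrightarrow> c \<in> cube_verts n \<rightarrow> {1..t}"

definition contains_mono_copy ::
  "nat \<Rightarrow> nat \<Rightarrow> nat \<Rightarrow> (nat set \<Rightarrow> nat) \<Rightarrow> nat set set \<Rightarrow> bool" where
  "contains_mono_copy t d n c F \<longleftrightarrow>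
     (\<exists>i \<in> {1..t}. contains_copy d n {A \<in> cube_verts n. c A = i} F)"

text \<open>The property is meant for \<^term>\<open>F \<subseteq> cube_verts d\<close>.\<close>

definition cube_ramsey :: "nat \<Rightarrow> nat \<Rightarrow> nat set set \<Rightarrow> bool" where
  "cube_ramsey t d F \<longleftrightarrow>
     (\<exists>n0. \<forall>n\<ge>n0. \<forall>c. cube_coloring t n c \<longrightarrow> contains_mono_copy t d n c F)"

text \<open>\<open>is_cube_clique a k K C\<close>: \<open>C\<close> is the clique of weight \<open>a\<close> and order \<open>k\<close> with vertex
  set \<open>K\<close>.  The vertex set is a separate argument because it is not determined by \<open>C\<close> in
  degenerate cases such as \<open>a = 0\<close>.\<close>

definition is_cube_clique :: "nat \<Rightarrow> nat \<Rightarrow> nat set \<Rightarrow> nat set set \<Rightarrow> bool" where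
  "is_cube_clique a k K C \<longleftrightarrow> finite K \<and> card K = k \<and> C = nsets K a"

end

theory Submission
  imports Defs
begin

text \<open>
  Every embedding of cubes has the form \<open>A \<mapsto> X \<triangle> \<sigma>(A)\<close> with \<open>\<sigma>\<close> injective, and by Ramsey's theorem
  every coloring depends only on the cardinality on some large subcube. So only colorings \<open>P\<close> of
  the integers by cardinality matter: with \<open>s = |X|\<close> and \<open>Y = \<sigma>\<^sup>-\<^sup>1(X)\<close>, the image of \<open>A\<close> lies on level
  \<open>s + |A| - 2|Y \<inter> A|\<close>. For a clique of weight \<open>a\<close> and order \<open>a + t\<close> one may realise the single
  level \<open>s + a\<close> or \<open>s - a\<close>; every copy avoiding both of these levels meets \<open>t + 1\<close> consecutive
  levels of the same parity.

  Without a monochromatic copy, \<open>P(s + a\<^sub>1) = P(s - a\<^sub>1) \<noteq> P(s + a\<^sub>2) = P(s - a\<^sub>2)\<close> for all \<open>s\<close>. This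
  is contradictory at a common odd multiple of \<open>a\<^sub>1\<close> and \<open>a\<^sub>2\<close> if \<open>r\<^sub>1 = r\<^sub>2\<close>. If \<open>t\<^sub>1 = 0\<close>, all levels
  of \<open>s - a\<^sub>1, s - a\<^sub>1 + 2, \<dots>, s + a\<^sub>1\<close> are available, so \<open>P(s) = P(s + 2)\<close>; if \<open>t\<^sub>1 = 1\<close>, all pairs
  of neighbours among them are, so \<open>P(s) \<noteq> P(s + 2)\<close>. In the remaining cases the colorings by the
  parity of \<open>l\<close>, of \<open>l div 2\<close>, or of \<open>l div 2 + l div 2 ^ r\<^sub>1\<close> have no monochromatic copy.
\<close>

section \<open>Embeddings and layered colorings\<close>

text \<open>Induction on \<open>card A\<close>: the edges at \<open>{}\<close> define
  \<open>\<sigma>\<close>, and two distinct elements of \<open>A\<close> give two neighbours with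
  known images, which pin down \<open>\<psi> A\<close>.\<close>

lemma cube_embedding_translate:
  assumes emb: "cube_embedding d n \<psi>"
  obtains \<sigma> where "inj_on \<sigma> {1..d}" "\<And>A. A \<subseteq> {1..d} \<Longrightarrow> \<psi> A = sym_diff (\<psi> {}) (\<sigma> ` A)"
proof -
  define X where "X = \<psi> {}"
  have inj: "A = B" if "\<psi> A = \<psi> B" "A \<subseteq> {1..d}" "B \<subseteq> {1..d}" for A B
    using emb that unfolding cube_embedding_def cube_verts_def inj_on_def by blast
  have adj: "\<exists>x. sym_diff (\<psi> A) (\<psi> (insert i A)) = {x}"
    if "A \<subseteq> {1..d}" "i \<in> {1..d}" "i \<notin> A" for A i
  proof -
    have "sym_diff A (insert i A) = {i}" using that by auto
    then have "cube_adj A (insert i A)" by (simp add: cube_adj_def)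
    then show ?thesis
      using emb that unfolding cube_embedding_def cube_verts_def cube_adj_def
      by (auto simp: card_1_singleton_iff)
  qed
  define \<sigma> where "\<sigma> i = the_elem (sym_diff X (\<psi> {i}))" for i
  have \<sigma>: "sym_diff X (\<psi> {i}) = {\<sigma> i}" if "i \<in> {1..d}" for i
    using adj[of "{}" i] that unfolding X_def \<sigma>_def by fastforce
  have \<sigma>': "\<psi> {i} = sym_diff X {\<sigma> i}" if "i \<in> {1..d}" for i
    using \<sigma>[OF that] by blast
  have inj\<sigma>: "inj_on \<sigma> {1..d}"
    by (rule inj_onI) (metis \<sigma>' inj empty_subsetI insert_subset singleton_inject)
  have main: "\<psi> A = sym_diff X (\<sigma> ` A)" if "A \<subseteq> {1..d}" for A
    using that
  proof (induction "card A" arbitrary: A rule: less_induct)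
    case less
    have fin: "finite A" using less.prems finite_subset by blast
    show ?case
    proof (cases "\<exists>i j. i \<in> A \<and> j \<in> A \<and> i \<noteq> j")
      case True
      then obtain i j where ij: "i \<in> A" "j \<in> A" "i \<noteq> j" by blast
      have IH: "\<psi> B = sym_diff X (\<sigma> ` B)" if "B \<subset> A" for B
        using less that fin by (meson psubset_card_mono psubset_imp_subset subset_trans)
      have img: "\<sigma> ` (A - B) = \<sigma> ` A - \<sigma> ` B" if "B \<subseteq> A" for B
        using inj_on_image_set_diff[OF inj\<sigma>, of A B] less.prems that by auto
      have ne: "\<sigma> i \<noteq> \<sigma> j" using inj\<sigma> ij less.prems by (auto simp: inj_on_def)
      have mem: "\<sigma> i \<in> \<sigma> ` A" "\<sigma> j \<in> \<sigma> ` A" using ij by auto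
      have e1: "\<psi> (A - {i}) = sym_diff X (\<sigma> ` A - {\<sigma> i})"
        using IH[of "A - {i}"] img[of "{i}"] ij by auto
      have e2: "\<psi> (A - {j}) = sym_diff X (\<sigma> ` A - {\<sigma> j})"
        using IH[of "A - {j}"] img[of "{j}"] ij by auto
      have e3: "\<psi> (A - {i,j}) = sym_diff X (\<sigma> ` A - {\<sigma> i, \<sigma> j})"
        using IH[of "A - {i,j}"] img[of "{i,j}"] ij by auto
      have step: "\<exists>x. sym_diff (\<psi> (A - {k})) (\<psi> A) = {x}" if "k \<in> A" for k
      proof -
        have "A - {k} \<subseteq> {1..d}" "k \<in> {1..d}" "k \<notin> A - {k}" using that less.prems by blast+
        from adj[OF this] show ?thesis using that by (simp only: insert_Diff)
      qed
      obtain x y where x: "sym_diff (\<psi> (A - {i})) (\<psi> A) = {x}"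
        and y: "sym_diff (\<psi> (A - {j})) (\<psi> A) = {y}"
        using step[OF ij(1)] step[OF ij(2)] by blast
      have "\<psi> A \<noteq> \<psi> (A - {i,j})" using inj[of A "A - {i,j}"] ij less.prems by auto
      then obtain z where z: "z \<in> \<psi> A \<longleftrightarrow> z \<notin> \<psi> (A - {i,j})" by blast
      have X1: "(u \<in> \<psi> (A - {i})) = (u \<in> \<psi> A) \<longleftrightarrow> u \<noteq> x" for u using x by blast
      have Y1: "(u \<in> \<psi> (A - {j})) = (u \<in> \<psi> A) \<longleftrightarrow> u \<noteq> y" for u using y by blast
      have E1: "u \<in> \<psi> (A - {i}) \<longleftrightarrow> (u \<in> X) \<noteq> (u \<in> \<sigma> ` A \<and> u \<noteq> \<sigma> i)" for u
        unfolding e1 by blast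
      have E2: "u \<in> \<psi> (A - {j}) \<longleftrightarrow> (u \<in> X) \<noteq> (u \<in> \<sigma> ` A \<and> u \<noteq> \<sigma> j)" for u
        unfolding e2 by blast
      have E3: "u \<in> \<psi> (A - {i,j}) \<longleftrightarrow> (u \<in> X) \<noteq> (u \<in> \<sigma> ` A \<and> u \<noteq> \<sigma> i \<and> u \<noteq> \<sigma> j)" for u
        unfolding e3 by blast
      \<comment> \<open>\<open>\<psi> (A - {i})\<close> and \<open>\<psi> (A - {j})\<close> have only two common neighbours, and by injectivity
        \<open>\<psi> A\<close> is not \<open>\<psi> (A - {i, j})\<close>.\<close>
      have "x = \<sigma> i"
      proof (rule ccontr)
        assume "x \<noteq> \<sigma> i"
        then have "y = \<sigma> i"
          using X1[of "\<sigma> i"] Y1[of "\<sigma> i"] E1[of "\<sigma> i"] E2[of "\<sigma> i"] mem ne by blast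
        moreover from this ne have "x = \<sigma> j"
          using X1[of "\<sigma> j"] Y1[of "\<sigma> j"] E1[of "\<sigma> j"] E2[of "\<sigma> j"] mem by blast
        ultimately show False
          using z X1[of z] E1[of z] E3[of z] mem ne by (cases "z = \<sigma> i"; cases "z = \<sigma> j") auto
      qed
      then have "u \<in> \<psi> A \<longleftrightarrow> (u \<in> X) \<noteq> (u \<in> \<sigma> ` A)" for u
        using X1[of u] E1[of u] mem by (cases "u = \<sigma> i") auto
      then show ?thesis by blast
    next
      case False
      then consider "A = {}" | i where "A = {i}" by blast
      then show ?thesis
        using \<sigma>' less.prems by cases (auto simp: X_def)
    qed
  qed
  show thesis using that[OF inj\<sigma>] main unfolding X_def by blast
qed

text \<open>The converse construction. The translating set is split into \<open>Z\<close>, outside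
  the range of \<open>\<sigma>\<close>, and the image of \<open>Y\<close>, so that cardinalities of
  images simply add. Symmetric differences are carried to their images under
  \<open>\<sigma>\<close>, which yields both adjacency and injectivity.\<close>

lemma cube_embedding_extend:
  fixes \<sigma> :: "nat \<Rightarrow> nat"
  assumes "1 \<le> d" and inj: "inj_on \<sigma> {1..d}" and "Y \<subseteq> {1..d}"
    and Z: "Z \<inter> \<sigma> ` {1..d} = {}" and sub: "Z \<subseteq> {1..n}" "\<sigma> ` {1..d} \<subseteq> {1..n}"
  shows "cube_embedding d n (\<lambda>A. Z \<union> \<sigma> ` sym_diff Y A)"
proof -
  have "d \<le> n"
    using card_mono[OF _ sub(2)] card_image[OF inj] by simp
  have diff: "sym_diff (Z \<union> \<sigma> ` sym_diff Y A) (Z \<union> \<sigma> ` sym_diff Y B) = \<sigma> ` sym_diff A B"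
    if "A \<subseteq> {1..d}" "B \<subseteq> {1..d}" for A B
  proof -
    have d1: "\<sigma> ` (C - D) = \<sigma> ` C - \<sigma> ` D" if "C \<subseteq> {1..d}" "D \<subseteq> {1..d}" for C D
      using inj_on_image_set_diff[OF inj, of C D] that by auto
    have "sym_diff (Z \<union> \<sigma> ` sym_diff Y A) (Z \<union> \<sigma> ` sym_diff Y B)
        = sym_diff (\<sigma> ` sym_diff Y A) (\<sigma> ` sym_diff Y B)"
      using Z that \<open>Y \<subseteq> _\<close> by blast
    also have "\<dots> = \<sigma> ` sym_diff (sym_diff Y A) (sym_diff Y B)"
    proof -
      have "sym_diff Y A \<subseteq> {1..d}" "sym_diff Y B \<subseteq> {1..d}" using that \<open>Y \<subseteq> _\<close> by blast+
      then show ?thesis by (simp only: image_Un[of \<sigma> "sym_diff Y A - sym_diff Y B"] d1)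
    qed
    also have "sym_diff (sym_diff Y A) (sym_diff Y B) = sym_diff A B" by blast
    finally show ?thesis .
  qed
  have "cube_adj (Z \<union> \<sigma> ` sym_diff Y A) (Z \<union> \<sigma> ` sym_diff Y B)"
    if "A \<subseteq> {1..d}" "B \<subseteq> {1..d}" "cube_adj A B" for A B
  proof -
    have "card (\<sigma> ` sym_diff A B) = card (sym_diff A B)"
      using inj that by (intro card_image) (auto intro: inj_on_subset)
    then show ?thesis using that(3) unfolding cube_adj_def diff[OF that(1,2)] by simp
  qed
  moreover have "inj_on (\<lambda>A. Z \<union> \<sigma> ` sym_diff Y A) (Pow {1..d})"
  proof (rule inj_onI)
    fix A B assume "A \<in> Pow {1..d}" "B \<in> Pow {1..d}"
      and eq: "Z \<union> \<sigma> ` sym_diff Y A = Z \<union> \<sigma> ` sym_diff Y B"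
    then have "\<sigma> ` sym_diff A B = {}" using diff[of A B] by simp
    then show "A = B" by blast
  qed
  moreover have "Z \<union> \<sigma> ` sym_diff Y A \<subseteq> {1..n}" if "A \<subseteq> {1..d}" for A
    using sub that \<open>Y \<subseteq> _\<close> by blast
  ultimately show ?thesis
    using \<open>1 \<le> d\<close> \<open>d \<le> n\<close> unfolding cube_embedding_def cube_verts_def by blast
qed

section \<open>Reduction to colorings by cardinality\<close>

text \<open>Induction on \<open>l\<close>: Ramsey's theorem for \<open>l\<close>-sets gives a
  homogeneous set large enough for the induction hypothesis, which is then applied inside it. The
  injection \<open>g\<close> transfers from the ground set \<open>{..<N}\<close> to
  \<open>M\<close>.\<close>

lemma Ramsey_all_sizes:
  fixes c :: "'a set \<Rightarrow> bool"
  shows "\<exists>n. \<forall>M c. finite (M :: 'a set) \<and> n \<le> card M \<longrightarrow>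
     (\<exists>H\<subseteq>M. card H = m \<and> (\<forall>k<l. \<exists>b::bool. \<forall>A\<in>nsets H k. c A = b))"
proof (induction l)
  case 0
  show ?case by (rule exI[of _ m]) (use obtain_subset_with_card_n in \<open>metis less_nat_zero_code\<close>)
next
  case (Suc l)
  then obtain n where n: "\<And>M c. finite (M :: 'a set) \<Longrightarrow> n \<le> card M \<Longrightarrow>
     (\<exists>H\<subseteq>M. card H = m \<and> (\<forall>k<l. \<exists>b::bool. \<forall>A\<in>nsets H k. c A = b))" by metis
  obtain N :: nat where N: "partn_lst {..<N} [n, n] l" using ramsey_full by blast
  have "\<exists>H\<subseteq>M. card H = m \<and> (\<forall>k<Suc l. \<exists>b::bool. \<forall>A\<in>nsets H k. c A = b)"
    if M: "finite M" "N \<le> card M" for M :: "'a set" and c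
  proof -
    obtain g where g: "inj_on g {..<N}" "g ` {..<N} \<subseteq> M"
      using M by (metis card_le_inj card_lessThan finite_lessThan)
    have "(\<lambda>A. if c (g ` A) then 0 else 1) \<in> nsets {..<N} l \<rightarrow> {..<length [n,n]}" by auto
    then obtain i H where i: "i < 2" and H: "H \<in> nsets {..<N} ([n,n] ! i)"
      and mono: "(\<lambda>A. if c (g ` A) then 0 else 1::nat) ` nsets H l \<subseteq> {i}"
      using N unfolding partn_lst_def monochromatic_def by (metis length_Cons list.size(3) numeral_2_eq_2)
    have "[n,n] ! i = n" using i by (cases i) auto
    with H have H: "H \<subseteq> {..<N}" "card H = n" by (auto simp: nsets_def)
    have inj: "inj_on g H" using g H inj_on_subset by blast
    have "finite (g ` H)" "card (g ` H) = n" "g ` H \<subseteq> M"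
      using H g inj by (auto simp: card_image finite_subset)
    with n[of "g ` H" c] obtain H' where H': "H' \<subseteq> g ` H" "card H' = m"
      "\<And>k. k < l \<Longrightarrow> \<exists>b::bool. \<forall>A\<in>nsets H' k. c A = b" by auto
    have "c A = (i = 0)" if "A \<in> nsets H' l" for A
    proof -
      have "A \<subseteq> g ` H" "card A = l" using that H'(1) by (auto simp: nsets_def)
      then obtain B where B: "B \<subseteq> H" "A = g ` B" unfolding subset_image_iff by blast
      have "card B = l" using card_image[OF inj_on_subset[OF inj B(1)]] \<open>card A = l\<close> B(2) by metis
      moreover have "finite B" using finite_subset[OF B(1) finite_subset[OF H(1)]] by simp
      ultimately have "B \<in> nsets H l" using B(1) by (simp add: nsets_def)
      then have "(if c (g ` B) then 0 else 1) = i" using mono unfolding image_subset_iff by simp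
      then show ?thesis unfolding B(2) by (auto split: if_splits)
    qed
    then have "\<exists>b. \<forall>A\<in>nsets H' k. c A = b" if "k < Suc l" for k
      using that H'(3)[of k] less_Suc_eq[of k l] by metis
    moreover have "H' \<subseteq> M" using H'(1) \<open>g ` H \<subseteq> M\<close> by (rule order_trans)
    ultimately show ?thesis using H'(2) by (intro exI[of _ H']) simp
  qed
  then show ?case by blast
qed

text \<open>The bound \<open>N\<close> is the same for every \<open>P\<close>, so one
  \<open>n0\<close> serves all colorings: a homogeneous set of size \<open>d + N\<close> has room
  for \<open>d\<close> moving coordinates and \<open>z\<close> constant ones.\<close>

lemma cube_ramsey_if_layered:
  assumes "1 \<le> d" and S: "S \<subseteq> cube_verts d"
    and layered: "\<And>P::nat\<Rightarrow>bool. \<exists>z\<le>N. \<exists>Y\<subseteq>{1..d}. \<exists>b. \<forall>A\<in>S. P (z + card (sym_diff Y A)) = b"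
  shows "cube_ramsey 2 d S"
proof -
  obtain n0 where n0: "\<And>M c. finite (M :: nat set) \<Longrightarrow> n0 \<le> card M \<Longrightarrow>
     (\<exists>H\<subseteq>M. card H = d + N \<and> (\<forall>k<Suc (d + N). \<exists>b::bool. \<forall>A\<in>nsets H k. c A = b))"
    using Ramsey_all_sizes by metis
  have "contains_mono_copy 2 d n c S" if n: "n0 \<le> n" and c: "cube_coloring 2 n c" for n c
  proof -
    obtain H where H: "H \<subseteq> {1..n}" "card H = d + N"
      and mono: "\<And>k. k < Suc (d + N) \<Longrightarrow> \<exists>b. \<forall>A\<in>nsets H k. (c A = 1) = b"
      using n0[of "{1..n}" "\<lambda>A. c A = 1"] n by auto
    have finH: "finite H" using H finite_subset by blast
    obtain P where P: "\<And>k A. k < Suc (d + N) \<Longrightarrow> A \<in> nsets H k \<Longrightarrow> (c A = 1) = P k"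
      using mono by metis
    obtain z Y b where z: "z \<le> N" and Y: "Y \<subseteq> {1..d}"
      and b: "\<And>A. A \<in> S \<Longrightarrow> P (z + card (sym_diff Y A)) = b"
      using layered[of P] by blast
    obtain \<sigma> where \<sigma>: "inj_on \<sigma> {1..d}" "\<sigma> ` {1..d} \<subseteq> H"
      using card_le_inj[of "{1..d}" H] finH H by auto
    have "card (H - \<sigma> ` {1..d}) = N"
      using \<sigma> H finH by (simp add: card_Diff_subset card_image)
    with z obtain Z where Z: "Z \<subseteq> H - \<sigma> ` {1..d}" "card Z = z"
      by (metis obtain_subset_with_card_n)
    have finZ: "finite Z" using Z finH finite_subset by blast
    let ?\<psi> = "\<lambda>A. Z \<union> \<sigma> ` sym_diff Y A"
    have emb: "cube_embedding d n ?\<psi>"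
      using Z \<sigma> H by (intro cube_embedding_extend assms Y) auto
    have col: "(c (?\<psi> A) = 1) = b" if "A \<in> S" for A
    proof -
      have A: "A \<subseteq> {1..d}" using that S by (auto simp: cube_verts_def)
      have sd: "sym_diff Y A \<subseteq> {1..d}" using A Y by blast
      then have fin: "finite (sym_diff Y A)" using finite_subset by blast
      have "card (?\<psi> A) = card Z + card (\<sigma> ` sym_diff Y A)"
        using finZ Z sd fin by (intro card_Un_disjoint) auto
      also have "card (\<sigma> ` sym_diff Y A) = card (sym_diff Y A)"
        using \<sigma> sd by (intro card_image) (rule inj_on_subset)
      finally have card: "card (?\<psi> A) = z + card (sym_diff Y A)" using Z by simp
      moreover have "card (sym_diff Y A) \<le> d" using card_mono[OF _ sd] by simp
      moreover have "?\<psi> A \<subseteq> H" using Z \<sigma> sd by blast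
      ultimately show ?thesis
        using P[of "card (?\<psi> A)" "?\<psi> A"] b[OF that] z finH by (auto simp: nsets_def finite_subset)
    qed
    have "?\<psi> A \<in> {B \<in> cube_verts n. c B = (if b then 1 else 2)}" if "A \<in> S" for A
    proof -
      have "?\<psi> A \<in> cube_verts n"
        using emb that S unfolding cube_embedding_def by blast
      moreover from this have "c (?\<psi> A) = 1 \<or> c (?\<psi> A) = 2"
        using c funcset_mem[of c "cube_verts n" "{1..2}" "?\<psi> A"] unfolding cube_coloring_def atLeastAtMost_iff by linarith
      ultimately show ?thesis using col[OF that] by auto
    qed
    then have "contains_copy d n {B \<in> cube_verts n. c B = (if b then 1 else 2)} S"
      using emb unfolding contains_copy_def by blast
    then show ?thesis unfolding contains_mono_copy_def
      by (intro bexI[of _ "if b then 1 else 2"]) auto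
  qed
  then show ?thesis unfolding cube_ramsey_def by blast
qed

lemma card_sym_diff_int:
  assumes "finite X" "finite A"
  shows "int (card (sym_diff X A)) = int (card X) + int (card A) - 2 * int (card (X \<inter> A))"
proof -
  have "card (sym_diff X A) = card (X - A) + card (A - X)"
    using assms by (intro card_Un_disjoint) auto
  moreover have "card X = card (X - A) + card (X \<inter> A)" "card A = card (A - X) + card (X \<inter> A)"
    using assms card_Diff_subset_Int[of X A] card_Diff_subset_Int[of A X]
     card_mono[of X "X \<inter> A"] card_mono[of A "X \<inter> A"] by (auto simp: Int_commute)
  ultimately show ?thesis by simp
qed

text \<open>The Ramsey property is tested on the coloring that applies \<open>P\<close> to
  cardinalities. Taking \<open>P\<close> on the integers keeps the level formula free of truncated
  subtraction.\<close>

lemma layered_if_cube_ramsey: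
  fixes P :: "int \<Rightarrow> bool"
  assumes "cube_ramsey 2 d S" "S \<subseteq> cube_verts d"
  obtains s Y b where "Y \<subseteq> {1..d}" "\<And>A. A \<in> S \<Longrightarrow> P (s + int (card A) - 2 * int (card (Y \<inter> A))) = b"
proof -
  define c :: "nat set \<Rightarrow> nat" where "c A = (if P (int (card A)) then 1 else 2)" for A
  obtain n where n: "\<And>c. cube_coloring 2 n c \<Longrightarrow> contains_mono_copy 2 d n c S"
    using assms(1) unfolding cube_ramsey_def by blast
  have "cube_coloring 2 n c" by (auto simp: cube_coloring_def c_def)
  from n[OF this] obtain i \<psi> where \<psi>: "cube_embedding d n \<psi>"
    and mono: "\<And>A. A \<in> S \<Longrightarrow> c (\<psi> A) = i"
    unfolding contains_mono_copy_def contains_copy_def image_subset_iff mem_Collect_eq by metis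
  obtain \<sigma> where \<sigma>: "inj_on \<sigma> {1..d}" "\<And>A. A \<subseteq> {1..d} \<Longrightarrow> \<psi> A = sym_diff (\<psi> {}) (\<sigma> ` A)"
    using cube_embedding_translate[OF \<psi>] by blast
  define X where "X = \<psi> {}"
  have "X \<subseteq> {1..n}" using \<psi> unfolding X_def cube_embedding_def cube_verts_def by blast
  then have finX: "finite X" using finite_subset by blast
  define Y where "Y = {i \<in> {1..d}. \<sigma> i \<in> X}"
  have "P (int (card X) + int (card A) - 2 * int (card (Y \<inter> A))) = (i = 1)" if "A \<in> S" for A
  proof -
    have A: "A \<subseteq> {1..d}" using that assms(2) by (auto simp: cube_verts_def)
    then have finA: "finite A" using finite_subset by blast
    have "X \<inter> \<sigma> ` A = \<sigma> ` (Y \<inter> A)" using A unfolding Y_def by auto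
    then have "card (X \<inter> \<sigma> ` A) = card (Y \<inter> A)"
      using \<sigma>(1) A card_image by (metis inf.coboundedI2 inj_on_subset)
    moreover have "card (\<sigma> ` A) = card A" using \<sigma>(1) A card_image inj_on_subset by blast
    ultimately have "int (card (\<psi> A)) = int (card X) + int (card A) - 2 * int (card (Y \<inter> A))"
      using card_sym_diff_int[OF finX, of "\<sigma> ` A"] finA \<sigma>(2)[OF A] unfolding X_def by simp
    then show ?thesis using mono[OF that] unfolding c_def by (auto split: if_splits)
  qed
  then show thesis using that[of Y] unfolding Y_def by blast
qed

section \<open>Levels of a clique\<close>

text \<open>Levels relative to \<open>s\<close>: a translation of size \<open>s\<close> whose
  preimage meets \<open>V\<close> in \<open>Y\<close> puts the clique on the levels
  \<open>s + \<delta>\<close> with \<open>\<delta>\<close> in this set.\<close>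

definition offsets :: "nat set \<Rightarrow> nat \<Rightarrow> nat set \<Rightarrow> int set" where
  "offsets V a Y = (\<lambda>A. int a - 2 * int (card (Y \<inter> A))) ` nsets V a"

lemma offsets_empty: "offsets V a {} \<subseteq> {int a}"
  by (auto simp: offsets_def)

lemma offsets_self: "offsets V a V \<subseteq> {- int a}"
proof -
  have "card (V \<inter> A) = a" if "A \<in> nsets V a" for A
    using that by (simp add: nsets_def Int_absorb1)
  then show ?thesis by (auto simp: offsets_def)
qed

lemma offsets_parity: "\<delta> \<in> offsets V a Y \<Longrightarrow> even (\<delta> - int a)"
  by (auto simp: offsets_def)

lemma offsets_nonempty:
  assumes "finite V" "a \<le> card V"
  shows "\<exists>\<delta>. \<delta> \<in> offsets V a Y"
proof -
  have "nsets V a \<noteq> {}" using assms by (simp add: nsets_eq_empty_iff)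
  then show ?thesis by (auto simp: offsets_def)
qed

text \<open>The clique has \<open>V\<close> as its only member, so a \<open>Y\<close> of size
  \<open>x\<close> fixes the level.\<close>

lemma offsets_no_slack:
  assumes "finite V" "card V = a" "x \<le> a"
  obtains Y where "Y \<subseteq> V" "offsets V a Y \<subseteq> {int a - 2 * int x}"
proof -
  obtain Y where Y: "Y \<subseteq> V" "card Y = x" using assms by (metis obtain_subset_with_card_n)
  have "A = V" if "A \<in> nsets V a" for A
    using that assms card_subset_eq by (auto simp: nsets_def)
  then have "card (Y \<inter> A) = x" if "A \<in> nsets V a" for A
    using that Y by (metis Int_absorb2)
  then have "offsets V a Y \<subseteq> {int a - 2 * int x}"
    by (auto simp: offsets_def)
  with Y that show thesis by blast
qed

text \<open>Each member omits exactly one vertex of \<open>V\<close>, hence at most one element of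
  \<open>Y\<close>.\<close>

lemma offsets_slack_one:
  assumes "finite V" "card V = Suc a" "1 \<le> x" "x \<le> a"
  obtains Y where "Y \<subseteq> V" "offsets V a Y \<subseteq> {int a - 2 * int x, int a - 2 * int x + 2}"
proof -
  have "x \<le> card V" using assms by simp
  then obtain Y where Y: "Y \<subseteq> V" "card Y = x" by (metis obtain_subset_with_card_n)
  have "card (Y \<inter> A) = x \<or> card (Y \<inter> A) = x - 1" if A: "A \<in> nsets V a" for A
  proof -
    have fin: "finite Y" "finite A" using A assms Y finite_subset by (auto simp: nsets_def)
    have "card (V - A) = 1" using A assms by (simp add: nsets_def card_Diff_subset)
    moreover have "card (Y - A) \<le> card (V - A)" using Y assms by (intro card_mono) auto
    moreover have "card Y = card (Y - A) + card (Y \<inter> A)"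
      using fin card_Diff_subset_Int[of Y A] card_mono[of Y "Y \<inter> A"] by auto
    ultimately show ?thesis using Y by linarith
  qed
  then have "offsets V a Y \<subseteq> {int a - 2 * int x, int a - 2 * int x + 2}"
    using assms by (fastforce simp: offsets_def)
  with Y that show thesis by blast
qed

text \<open>A member meeting \<open>Y\<close> in \<open>j\<close> points takes \<open>j\<close>
  points of \<open>Y\<close> and \<open>a - j\<close> others; \<open>card Y \<le> t + j\<close> says
  that enough others exist.\<close>

lemma offsets_mem:
  assumes "finite V" "card V = a + t" "Y \<subseteq> V" "j \<le> card Y" "j \<le> a" "card Y \<le> t + j"
  shows "int a - 2 * int j \<in> offsets V a Y"
proof -
  have finY: "finite Y" using assms finite_subset by blast
  obtain B where B: "B \<subseteq> Y" "card B = j" using assms by (metis obtain_subset_with_card_n)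
  have "a - j \<le> card (V - Y)" using assms finY by (simp add: card_Diff_subset)
  then obtain C where C: "C \<subseteq> V - Y" "card C = a - j" by (metis obtain_subset_with_card_n)
  have fin: "finite B" "finite C" using B C assms finY finite_subset by blast+
  have "card (B \<union> C) = a" using B C fin assms by (subst card_Un_disjoint) auto
  then have "B \<union> C \<in> nsets V a" using B C assms fin by (auto simp: nsets_def)
  moreover have "Y \<inter> (B \<union> C) = B" using B C by blast
  ultimately show ?thesis using B unfolding offsets_def by (intro image_eqI[of _ _ "B \<union> C"]) simp_all
qed

text \<open>The size of \<open>Y \<inter> A\<close> can be \<open>0\<close> if
  \<open>card Y \<le> t\<close>, and \<open>a\<close> if \<open>a \<le> card Y\<close>. Otherwise it
  takes all \<open>t + 1\<close> values from \<open>card Y - t\<close> to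
  \<open>card Y\<close>.\<close>

lemma offsets_trichotomy:
  assumes "finite V" "card V = a + t" "Y \<subseteq> V"
  obtains "int a \<in> offsets V a Y" | "- int a \<in> offsets V a Y"
    | \<delta> where "\<And>i. i \<le> t \<Longrightarrow> \<delta> - 2 * int i \<in> offsets V a Y"
proof -
  consider "card Y \<le> t" | "a \<le> card Y" | "t < card Y" "card Y < a" by linarith
  then show thesis
  proof cases
    case 1
    then show ?thesis using that(1) offsets_mem[OF assms, of 0] by simp
  next
    case 2
    moreover have "card Y \<le> a + t" using assms by (metis card_mono)
    ultimately show ?thesis using that(2) offsets_mem[OF assms, of a] by simp
  next
    case 3
    have "(int a - 2 * int (card Y - t)) - 2 * int i \<in> offsets V a Y" if "i \<le> t" for i
      using 3 that offsets_mem[OF assms, of "card Y - t + i"] by (simp add: algebra_simps)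
    then show ?thesis by (rule that(3))
  qed
qed

section \<open>Pairs of disjoint cliques\<close>

locale clique_pair =
  fixes d a1 t1 :: nat and V1 :: "nat set" and a2 t2 :: nat and V2 :: "nat set"
  assumes d: "1 \<le> d" and V: "V1 \<subseteq> {1..d}" "V2 \<subseteq> {1..d}" "V1 \<inter> V2 = {}"
    and card_V: "card V1 = a1 + t1" "card V2 = a2 + t2"
    and pos: "0 < a1" "0 < a2"
begin

abbreviation S :: "nat set set" where "S \<equiv> nsets V1 a1 \<union> nsets V2 a2"

text \<open>Disjointness of \<open>V1\<close> and \<open>V2\<close> lets the traces
  \<open>Y1\<close> and \<open>Y2\<close> vary independently; only the shift \<open>s\<close> is
  shared.\<close>

definition mono_copy :: "(int \<Rightarrow> bool) \<Rightarrow> int \<Rightarrow> nat set \<Rightarrow> nat set \<Rightarrow> bool" where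
  "mono_copy P s Y1 Y2 \<longleftrightarrow> Y1 \<subseteq> V1 \<and> Y2 \<subseteq> V2 \<and>
     (\<exists>b. \<forall>\<delta>\<in>offsets V1 a1 Y1 \<union> offsets V2 a2 Y2. P (s + \<delta>) = b)"

lemma finite_V: "finite V1" "finite V2"
  using V finite_subset by blast+

lemma S_subset: "S \<subseteq> cube_verts d"
  using V by (auto simp: nsets_def cube_verts_def)

lemma swap: "clique_pair d a2 t2 V2 a1 t1 V1"
  using d V card_V pos unfolding clique_pair_def by blast

text \<open>Confining \<open>s\<close> to a window independent of \<open>P\<close> supplies the
  uniform bound on the number of constant coordinates.\<close>

lemma ramsey_if_mono:
  assumes P: "\<And>P. \<exists>s Y1 Y2. 0 \<le> s \<and> s \<le> N \<and> mono_copy P s Y1 Y2"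
  shows "cube_ramsey 2 d S"
proof (rule cube_ramsey_if_layered[OF d S_subset])
  fix P :: "nat \<Rightarrow> bool"
  \<comment> \<open>The coloring is shifted by \<open>d\<close> because \<open>card Y\<close>
    constant coordinates must be subtracted below; \<open>card Y \<le> d\<close> keeps
    \<open>z\<close> exact.\<close>
  obtain s Y1 Y2 b where s: "0 \<le> s" "s \<le> N" and Y: "Y1 \<subseteq> V1" "Y2 \<subseteq> V2"
    and b1: "\<And>\<delta>. \<delta> \<in> offsets V1 a1 Y1 \<Longrightarrow> P (nat (s + \<delta> + int d)) = b"
    and b2: "\<And>\<delta>. \<delta> \<in> offsets V2 a2 Y2 \<Longrightarrow> P (nat (s + \<delta> + int d)) = b"
    using P[of "\<lambda>i. P (nat (i + int d))"] unfolding mono_copy_def by blast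
  define Y where "Y = Y1 \<union> Y2"
  have Yd: "Y \<subseteq> {1..d}" using Y V unfolding Y_def by blast
  have finY: "finite Y" using Yd finite_subset by blast
  have cY: "card Y \<le> d" using card_mono[OF _ Yd] by simp
  define z where "z = nat s + d - card Y"
  have "P (z + card (sym_diff Y A)) = b" if "A \<in> S" for A
  proof -
    obtain a where a: "card A = a" by simp
    have "finite A" using that by (auto simp: nsets_def)
    then have "int (z + card (sym_diff Y A)) = s + (int a - 2 * int (card (Y \<inter> A))) + int d"
      using card_sym_diff_int[OF finY, of A] cY s a unfolding z_def by simp
    then have nat: "z + card (sym_diff Y A) = nat (s + (int a - 2 * int (card (Y \<inter> A))) + int d)"
      by linarith
    from that show ?thesis
    proof
      assume A: "A \<in> nsets V1 a1"
      then have "Y \<inter> A = Y1 \<inter> A" "a = a1" using Y V a unfolding Y_def by (auto simp: nsets_def)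
      then show ?thesis unfolding nat using A b1 by (auto simp: offsets_def)
    next
      assume A: "A \<in> nsets V2 a2"
      then have "Y \<inter> A = Y2 \<inter> A" "a = a2" using Y V a unfolding Y_def by (auto simp: nsets_def)
      then show ?thesis unfolding nat using A b2 by (auto simp: offsets_def)
    qed
  qed
  moreover have "z \<le> nat N + d" unfolding z_def using s by linarith
  ultimately show "\<exists>z\<le>nat N + d. \<exists>Y\<subseteq>{1..d}. \<exists>b. \<forall>A\<in>S. P (z + card (sym_diff Y A)) = b"
    using Yd by (intro exI[of _ z] exI[of _ Y] exI[of _ b] conjI ballI)
qed

lemma mono_if_ramsey:
  fixes P :: "int \<Rightarrow> bool"
  assumes "cube_ramsey 2 d S"
  shows "\<exists>s Y1 Y2. mono_copy P s Y1 Y2"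
proof -
  obtain s Y b where Y: "Y \<subseteq> {1..d}"
    and b: "\<And>A. A \<in> S \<Longrightarrow> P (s + int (card A) - 2 * int (card (Y \<inter> A))) = b"
    using layered_if_cube_ramsey[OF assms S_subset, of P] by metis
  have "P (s + \<delta>) = b" if \<delta>: "\<delta> \<in> offsets V1 a1 (Y \<inter> V1)" for \<delta>
  proof -
    obtain A where A: "A \<in> nsets V1 a1" "\<delta> = int a1 - 2 * int (card (Y \<inter> V1 \<inter> A))"
      using \<delta> unfolding offsets_def by blast
    then have "Y \<inter> V1 \<inter> A = Y \<inter> A" "card A = a1" by (auto simp: nsets_def)
    then show ?thesis using A b[of A] by (simp add: add_diff_eq)
  qed
  moreover have "P (s + \<delta>) = b" if \<delta>: "\<delta> \<in> offsets V2 a2 (Y \<inter> V2)" for \<delta>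
  proof -
    obtain A where A: "A \<in> nsets V2 a2" "\<delta> = int a2 - 2 * int (card (Y \<inter> V2 \<inter> A))"
      using \<delta> unfolding offsets_def by blast
    then have "Y \<inter> V2 \<inter> A = Y \<inter> A" "card A = a2" by (auto simp: nsets_def)
    then show ?thesis using A b[of A] by (simp add: add_diff_eq)
  qed
  ultimately show ?thesis unfolding mono_copy_def by (metis UnE inf_le2)
qed

lemma mono_copyI:
  assumes "Y1 \<subseteq> V1" "Y2 \<subseteq> V2" "offsets V1 a1 Y1 \<subseteq> D1" "offsets V2 a2 Y2 \<subseteq> D2"
    and "\<And>\<delta>. \<delta> \<in> D1 \<union> D2 \<Longrightarrow> P (s + \<delta>) = b"
  shows "mono_copy P s Y1 Y2"
  using assms unfolding mono_copy_def by (intro conjI exI[of _ b]) auto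

section \<open>Sufficiency: consequences of having no monochromatic copy\<close>

lemma mono_ends:
  assumes "e1 = int a1 \<or> e1 = - int a1" "e2 = int a2 \<or> e2 = - int a2" "P (s + e1) = P (s + e2)"
  shows "\<exists>Y1 Y2. mono_copy P s Y1 Y2"
proof -
  \<comment> \<open>The witnesses are \<open>{}\<close> for the upper end and \<open>W\<close>
    itself for the lower end.\<close>
  have "\<exists>Y\<subseteq>W. offsets W a Y \<subseteq> {e}" if "e = int a \<or> e = - int a" for a W e
    using that offsets_empty offsets_self by blast
  then obtain Y1 Y2 where "Y1 \<subseteq> V1" "Y2 \<subseteq> V2"
    "offsets V1 a1 Y1 \<subseteq> {e1}" "offsets V2 a2 Y2 \<subseteq> {e2}"
    using assms(1,2) by metis
  then have "mono_copy P s Y1 Y2" using assms(3) by (intro mono_copyI[where b = "P (s + e1)"]) auto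
  then show ?thesis by blast
qed

text \<open>Each end of one clique must differ in color from each end of the other; with two colors
  the two ends of a clique then agree.\<close>

lemma ends_if_not_mono:
  assumes "\<And>Y1 Y2. \<not> mono_copy P s Y1 Y2"
  shows "P (s + int a1) = P (s - int a1)" "P (s + int a2) = P (s - int a2)"
    "P (s + int a1) \<noteq> P (s + int a2)"
  using mono_ends[of "int a1" "int a2" P s] mono_ends[of "int a1" "- int a2" P s]
    mono_ends[of "- int a1" "int a2" P s] assms by auto

text \<open>Both ends agree around every center, so stepping through the centers
  \<open>w + (2 * k + 1) * a1\<close> gives period \<open>2 * a1\<close> inside the window.\<close>

lemma periodic_if_not_mono:
  assumes nm: "\<And>s Y1 Y2. 0 \<le> s \<Longrightarrow> s \<le> N \<Longrightarrow> \<not> mono_copy P s Y1 Y2"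
    and "0 \<le> w" "w + 2 * int k * int a1 \<le> N"
  shows "P (w + 2 * int k * int a1) = P w"
  using assms(3)
proof (induction k)
  case (Suc k)
  let ?s = "w + (2 * int k + 1) * int a1"
  have "0 \<le> ?s" "?s \<le> N" using Suc.prems \<open>0 \<le> w\<close> by (auto simp: algebra_simps)
  then have "P (?s + int a1) = P (?s - int a1)"
    using nm ends_if_not_mono(1) by blast
  then show ?case using Suc by (simp add: algebra_simps)
qed simp

lemma odd_multiple_if_not_mono:
  assumes "\<And>s Y1 Y2. 0 \<le> s \<Longrightarrow> s \<le> N \<Longrightarrow> \<not> mono_copy P s Y1 Y2"
    and "odd q" "int q * int a1 \<le> N"
  shows "P (int q * int a1) = P (int a1)"
proof -
  obtain k where "q = 2 * k + 1" using \<open>odd q\<close> oddE by blast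
  then have q: "int q * int a1 = int a1 + 2 * int k * int a1" by (simp add: algebra_simps)
  show ?thesis
    unfolding q using assms(1) by (rule periodic_if_not_mono) (use assms(3) q in auto)
qed

text \<open>The common odd multiple \<open>q2 * a1 = q1 * a2\<close> has the color of
  \<open>a1\<close> and, by symmetry, that of \<open>a2\<close>, while the ends around
  \<open>0\<close> force these two to differ.\<close>

lemma ramsey_same_valuation:
  assumes "odd q1" "odd q2" "q2 * a1 = q1 * a2"
  shows "cube_ramsey 2 d S"
proof (rule ramsey_if_mono[where N = "int q2 * int a1"], rule ccontr)
  fix P
  assume "\<not> (\<exists>s Y1 Y2. 0 \<le> s \<and> s \<le> int q2 * int a1 \<and> mono_copy P s Y1 Y2)"
  then have nm: "\<not> mono_copy P s Y1 Y2" if "0 \<le> s" "s \<le> int q2 * int a1" for s Y1 Y2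
    using that by blast
  interpret sw: clique_pair d a2 t2 V2 a1 t1 V1 by (rule swap)
  have "sw.mono_copy P s Y2 Y1 = mono_copy P s Y1 Y2" for s Y1 Y2
    unfolding sw.mono_copy_def mono_copy_def by blast
  then have nm': "\<not> sw.mono_copy P s Y2 Y1" if "0 \<le> s" "s \<le> int q2 * int a1" for s Y1 Y2
    using nm that by blast
  have "int q2 * int a1 = int q1 * int a2" using assms(3) by (metis of_nat_mult)
  then have "P (int a1) = P (int a2)"
    using odd_multiple_if_not_mono[OF nm \<open>odd q2\<close>] sw.odd_multiple_if_not_mono[OF nm' \<open>odd q1\<close>]
    by auto
  moreover have "P (0 + int a1) \<noteq> P (0 + int a2)"
    by (rule ends_if_not_mono(3)) (simp add: nm)
  ultimately show False by simp
qed

text \<open>The first clique can be put at offset \<open>0\<close> or \<open>2\<close>, so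
  \<open>s\<close> and \<open>s + 2\<close> both differ in color from \<open>s + a2\<close>. Hence
  even levels up to \<open>a2\<close> share one color, against offset \<open>0\<close> at
  \<open>s = 0\<close>.\<close>

lemma ramsey_no_slack:
  assumes "t1 = 0" "even a1" "even a2"
  shows "cube_ramsey 2 d S"
proof (rule ramsey_if_mono[where N = "int a2"], rule ccontr)
  fix P
  assume "\<not> (\<exists>s Y1 Y2. 0 \<le> s \<and> s \<le> int a2 \<and> mono_copy P s Y1 Y2)"
  then have nm: "\<not> mono_copy P s Y1 Y2" if "0 \<le> s" "s \<le> int a2" for s Y1 Y2
    using that by blast
  have ne: "P (s + (int a1 - 2 * int x)) \<noteq> P (s + int a2)"
    if s: "0 \<le> s" "s \<le> int a2" and x: "x \<le> a1" for s x
  proof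
    assume eq: "P (s + (int a1 - 2 * int x)) = P (s + int a2)"
    obtain Y where Y: "Y \<subseteq> V1" "offsets V1 a1 Y \<subseteq> {int a1 - 2 * int x}"
      using offsets_no_slack[OF finite_V(1) _ x] card_V assms(1) by auto
    have "mono_copy P s Y {}"
      using eq by (intro mono_copyI[OF Y(1) _ Y(2) offsets_empty]) auto
    then show False using nm s by blast
  qed
  have z: "P s \<noteq> P (s + int a2)" if "0 \<le> s" "s \<le> int a2" for s
    using ne[OF that, of "a1 div 2"] \<open>even a1\<close> by auto
  have "P (s + 2) \<noteq> P (s + int a2)" if "0 \<le> s" "s \<le> int a2" for s
  proof -
    have e: "int a1 - 2 * int (a1 div 2 - 1) = 2" using pos \<open>even a1\<close> by (auto elim!: evenE)
    have "a1 div 2 - 1 \<le> a1" by simp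
    from ne[OF that this] show ?thesis unfolding e .
  qed
  with z have step: "P (s + 2) = P s" if "0 \<le> s" "s \<le> int a2" for s
    using that by blast
  have "P (2 * int k) = P 0" if "2 * int k \<le> int a2" for k
    using that
  proof (induction k)
    case (Suc k)
    then show ?case using step[of "2 * int k"] by (simp add: algebra_simps)
  qed simp
  from this[of "a2 div 2"] have "P (int a2) = P 0" using \<open>even a2\<close> by auto
  with z[of 0] show False by simp
qed

text \<open>The first clique fits on any two neighbouring levels of its range, which forces the
  colors of \<open>w\<close> and \<open>w + 2\<close> to differ. Two such steps give period
  \<open>4\<close>, so \<open>a1\<close> and \<open>a2\<close> both get the color of
  \<open>0\<close>, against the ends around \<open>0\<close>.\<close>

lemma ramsey_slack_one:
  assumes "t1 = 1" "4 dvd a1" "4 dvd a2"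
  shows "cube_ramsey 2 d S"
proof (rule ramsey_if_mono[where N = "8 * int a1 + 8 * int a2"], rule ccontr)
  fix P
  let ?N = "8 * int a1 + 8 * int a2"
  assume "\<not> (\<exists>s Y1 Y2. 0 \<le> s \<and> s \<le> ?N \<and> mono_copy P s Y1 Y2)"
  then have nm: "\<not> mono_copy P s Y1 Y2" if "0 \<le> s" "s \<le> ?N" for s Y1 Y2
    using that by blast
  have even: "even (int a1)" "even (int a2)" using assms by auto
  have pair: False
    if s: "0 \<le> s" "s \<le> ?N" and k: "- int a1 \<le> k" "k < int a1" "even k"
      and eq: "P (s + k) = P (s + int a2)" "P (s + k + 2) = P (s + int a2)" for s k
  proof -
    have "even (int a1 - k)" using k even by simp
    then obtain m where m: "int a1 - k = 2 * m" by blast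
    define x where "x = nat m"
    have x: "int a1 - 2 * int x = k" "1 \<le> x" "x \<le> a1" using m k unfolding x_def by auto
    obtain Y where Y: "Y \<subseteq> V1" "offsets V1 a1 Y \<subseteq> {k, k + 2}"
      using offsets_slack_one[OF finite_V(1) _ x(2,3)] card_V assms(1) unfolding x(1) by auto
    have "mono_copy P s Y {}"
      using eq by (intro mono_copyI[OF Y(1) _ Y(2) offsets_empty]) (auto simp: add.assoc)
    then show False using nm s by blast
  qed
  have alt: "P (w + 2) \<noteq> P w" if w: "0 \<le> w" "w \<le> int a1 + int a2" for w
  proof
    assume eq: "P (w + 2) = P w"
    \<comment> \<open>As \<open>P\<close> has period \<open>2 * a1\<close>, some translate of the pair \<open>w, w + 2\<close> lies in the window of
      width \<open>2 * a1\<close> around \<open>u\<close>, while level \<open>u + a2\<close> has the color of \<open>w\<close>.\<close>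
    define u where "u = w + int a2"
    have "P (u + int a2) = P (u - int a2)"
      by (rule ends_if_not_mono(2)) (use nm w in \<open>simp add: u_def\<close>)
    then have u: "P (u + int a2) = P w" by (simp add: u_def)
    \<comment> \<open>This is the largest \<open>j\<close> with \<open>2 * j * a1 - a2 < a1\<close>;
      maximality gives the other bound \<open>- a1 \<le> k\<close>.\<close>
    define j where "j = (int a1 + int a2 - 1) div (2 * int a1)"
    define k where "k = 2 * int (nat j) * int a1 - int a2"
    have "0 \<le> j" unfolding j_def using pos by (simp add: pos_imp_zdiv_nonneg_iff)
    then have k_eq: "k = int a1 - 1 - (int a1 + int a2 - 1) mod (2 * int a1)"
      unfolding k_def j_def using div_mult_mod_eq[of "int a1 + int a2 - 1" "2 * int a1"]
      by (simp add: algebra_simps)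
    have "0 \<le> (int a1 + int a2 - 1) mod (2 * int a1)"
      "(int a1 + int a2 - 1) mod (2 * int a1) < 2 * int a1" using pos by auto
    then have k: "- int a1 \<le> k" "k < int a1" using k_eq by linarith+
    have "even k" unfolding k_def using even by simp
    have period: "P (v + 2 * int (nat j) * int a1) = P v" if "0 \<le> v" "v \<le> w + 2" for v
    proof (rule periodic_if_not_mono[where N = ?N])
      have "2 \<le> int a1" using even pos by presburger
      then show "v + 2 * int (nat j) * int a1 \<le> ?N" using that w k k_def by linarith
    qed (use nm that in auto)
    have shift: "u + k = w + 2 * int (nat j) * int a1" "u + k + 2 = (w + 2) + 2 * int (nat j) * int a1"
      by (simp_all add: u_def k_def)
    have "P (u + k) = P w" unfolding shift(1) by (rule period) (use w in auto)
    moreover have "P (u + k + 2) = P (w + 2)"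
      unfolding shift(2) by (rule period) (use w in auto)
    ultimately have "P (u + k) = P (u + int a2)" "P (u + k + 2) = P (u + int a2)"
      using u eq by auto
    moreover have "0 \<le> u" "u \<le> ?N" using w unfolding u_def by auto
    ultimately show False using pair k \<open>even k\<close> by blast
  qed
  have step: "P (w + 4) = P w" if "0 \<le> w" "w + 2 \<le> int a1 + int a2" for w
    using alt[of w] alt[of "w + 2"] that by (simp add: add.assoc)
  have "P (4 * int k) = P 0" if "4 * int k \<le> int a1 + int a2" for k
    using that
  proof (induction k)
    case (Suc k)
    then show ?case using step[of "4 * int k"] by (simp add: algebra_simps)
  qed simp
  from this[of "a1 div 4"] this[of "a2 div 4"] have "P (int a1) = P (int a2)"
    using assms by (auto elim!: dvdE)
  moreover have "P (0 + int a1) \<noteq> P (0 + int a2)"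
    by (rule ends_if_not_mono(3)) (simp add: nm)
  ultimately show False by simp
qed

section \<open>Necessity: colorings without a monochromatic copy\<close>

text \<open>Coloring by parity works: all levels of a clique have the parity of
  \<open>s + a\<close>, which differs for the two weights.\<close>

lemma not_ramsey_odd_even:
  assumes "odd a1" "even a2"
  shows "\<not> cube_ramsey 2 d S"
proof
  assume "cube_ramsey 2 d S"
  then obtain s Y1 Y2 where "mono_copy even s Y1 Y2" using mono_if_ramsey by blast
  then obtain b where Y: "Y1 \<subseteq> V1" "Y2 \<subseteq> V2"
    and b1: "\<And>\<delta>. \<delta> \<in> offsets V1 a1 Y1 \<Longrightarrow> even (s + \<delta>) = b"
    and b2: "\<And>\<delta>. \<delta> \<in> offsets V2 a2 Y2 \<Longrightarrow> even (s + \<delta>) = b"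
    unfolding mono_copy_def by blast
  have "\<exists>\<delta>. \<delta> \<in> offsets V1 a1 Y1" "\<exists>\<delta>. \<delta> \<in> offsets V2 a2 Y2"
    by (rule offsets_nonempty; simp add: finite_V card_V)+
  then obtain \<delta>1 \<delta>2 where "\<delta>1 \<in> offsets V1 a1 Y1" "\<delta>2 \<in> offsets V2 a2 Y2" by blast
  with b1 b2 have "even (s + \<delta>1) = even (s + \<delta>2)" "even (\<delta>1 - int a1)" "even (\<delta>2 - int a2)"
    using offsets_parity by blast+
  then show False using assms by simp
qed

text \<open>By \<open>long\<close>, a monochromatic clique cannot occupy a run of
  \<open>t + 1\<close> levels, so each clique reaches one of its ends. Both ends of the first have
  the color opposite to \<open>s\<close>, both ends of the second that of \<open>s\<close>.\<close>

lemma not_ramsey_if_coloring: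
  fixes P :: "int \<Rightarrow> bool"
  assumes "t \<le> t1" "t \<le> t2"
    and long: "\<And>l. \<exists>i\<le>t. P (l - 2 * int i) \<noteq> P l"
    and flip: "\<And>l. P (l + int a1) \<noteq> P l" and keep: "\<And>l. P (l + int a2) = P l"
  shows "\<not> cube_ramsey 2 d S"
proof
  assume "cube_ramsey 2 d S"
  then obtain s Y1 Y2 where "mono_copy P s Y1 Y2" using mono_if_ramsey by blast
  then obtain b where Y: "Y1 \<subseteq> V1" "Y2 \<subseteq> V2"
    and b1: "\<And>\<delta>. \<delta> \<in> offsets V1 a1 Y1 \<Longrightarrow> P (s + \<delta>) = b"
    and b2: "\<And>\<delta>. \<delta> \<in> offsets V2 a2 Y2 \<Longrightarrow> P (s + \<delta>) = b"
    unfolding mono_copy_def by blast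
  have no_run: False if "\<And>i. i \<le> t \<Longrightarrow> P (s + (\<delta> - 2 * int i)) = b" for \<delta>
  proof -
    obtain i where "i \<le> t" "P (s + \<delta> - 2 * int i) \<noteq> P (s + \<delta>)" using long by blast
    with that[of i] that[of 0] show False by (simp add: algebra_simps)
  qed
  have "P (s + int a1) = b \<or> P (s - int a1) = b"
    using offsets_trichotomy[OF finite_V(1) card_V(1) Y(1)]
  proof cases
    case (3 \<delta>)
    then show ?thesis using no_run[of \<delta>] b1 \<open>t \<le> t1\<close> by (meson order_trans)
  qed (use b1 in force)+
  moreover have "P (s + int a2) = b \<or> P (s - int a2) = b"
    using offsets_trichotomy[OF finite_V(2) card_V(2) Y(2)]
  proof cases
    case (3 \<delta>)
    then show ?thesis using no_run[of \<delta>] b2 \<open>t \<le> t2\<close> by (meson order_trans)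
  qed (use b2 in force)+
  ultimately show False
    using flip[of s] flip[of "s - int a1"] keep[of s] keep[of "s - int a2"] by auto
qed

text \<open>The parity of \<open>l div 2\<close> alternates along steps of \<open>2\<close>, flips
  under shifts by \<open>2\<close> modulo \<open>4\<close> and is kept by multiples of
  \<open>4\<close>.\<close>

lemma not_ramsey_two_mod_four:
  assumes "1 \<le> t1" "1 \<le> t2" "a1 mod 4 = 2" "4 dvd a2"
  shows "\<not> cube_ramsey 2 d S"
proof (rule not_ramsey_if_coloring[where P = "\<lambda>l. even (l div 2)" and t = 1])
  fix l :: int
  have "even ((l - 2 * int 1) div 2) \<noteq> even (l div 2)" by simp presburger
  then show "\<exists>i\<le>1. even ((l - 2 * int i) div 2) \<noteq> even (l div 2)" by blast
  have "int a1 mod 4 = 2" using assms(3) by presburger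
  then show "even ((l + int a1) div 2) \<noteq> even (l div 2)" by presburger
  have "4 dvd int a2" using assms(4) by presburger
  then show "even ((l + int a2) div 2) = even (l div 2)" by presburger
qed (use assms in auto)

text \<open>Two parity changes of \<open>l div q\<close> cannot occur within distance \<open>4 \<le> q\<close>, so no three consecutive
  levels of the same parity have one color.\<close>

lemma not_ramsey_slack_two:
  assumes "2 \<le> t1" "2 \<le> t2" "2 \<le> r" "a1 = p * 2 ^ r" "odd p" "2 ^ Suc r dvd a2"
  shows "\<not> cube_ramsey 2 d S"
proof -
  define q :: int where "q = 2 ^ r"
  have q4: "4 dvd q" unfolding q_def using le_imp_power_dvd[OF \<open>2 \<le> r\<close>, of "2::int"] by simp
  have qpos: "0 < q" by (simp add: q_def)
  with q4 have "4 \<le> q" by (simp add: zdvd_imp_le)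
  obtain h where h: "q = 2 * h" "even h" using q4 by (metis dvd_def dvd_triv_left mult.assoc mult_2 numeral_Bit0 one_add_one)
  obtain m where m: "a2 = 2 ^ Suc r * m" using assms by blast
  \<comment> \<open>Shifting by \<open>k * q\<close> adds \<open>k\<close> to \<open>l div q\<close>
    but the even number \<open>k * h\<close> to \<open>l div 2\<close>; evenness of \<open>h\<close>
    is where \<open>4 dvd q\<close> enters.\<close>
  have shift: "even ((l + k * q) div 2 + (l + k * q) div q) = (even (l div 2 + l div q) = even k)" for l k
  proof -
    have "(l + k * q) div q = l div q + k" using qpos by simp
    moreover have "(l + k * q) div 2 = l div 2 + k * h" using h by (simp add: mult.left_commute)
    ultimately show ?thesis using h by auto
  qed
  show ?thesis
  proof (rule not_ramsey_if_coloring[where P = "\<lambda>l. even (l div 2 + l div q)" and t = 2])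
    fix l :: int
    have a: "int a1 = int p * q" "int a2 = int (2 * m) * q"
      using assms m by (simp_all add: q_def)
    show "even ((l + int a1) div 2 + (l + int a1) div q) \<noteq> even (l div 2 + l div q)"
      unfolding a shift using \<open>odd p\<close> by simp
    show "even ((l + int a2) div 2 + (l + int a2) div q) = even (l div 2 + l div q)"
      unfolding a shift by simp
    show "\<exists>i\<le>2. even ((l - 2 * int i) div 2 + (l - 2 * int i) div q) \<noteq> even (l div 2 + l div q)"
    proof (rule ccontr)
      assume "\<not> ?thesis"
      then have c: "even ((l - 2 * int i) div 2 + (l - 2 * int i) div q) = even (l div 2 + l div q)"
        if "i \<le> 2" for i using that by blast
      have "even ((l - 2) div 2 + (l - 2) div q) = even (l div 2 + l div q)"
        "even ((l - 4) div 2 + (l - 4) div q) = even (l div 2 + l div q)"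
        using c[of 1] c[of 2] by simp_all
      moreover have "(l - 2) div 2 = l div 2 - 1" "(l - 4) div 2 = l div 2 - 2" by simp_all
      \<comment> \<open>Each step of \<open>2\<close> flips the parity of \<open>l div 2\<close>, so
        equal colors require \<open>l div q\<close> to flip along with it.\<close>
      ultimately have par: "even ((l - 2) div q) \<noteq> even (l div q)" "even ((l - 4) div q) = even (l div q)"
        by auto
      have "(l - q) div q = l div q - 1" using div_mult_self1[of q l "- 1"] qpos by simp
      moreover have "(l - q) div q \<le> (l - 4) div q" "(l - 4) div q \<le> (l - 2) div q"
        "(l - 2) div q \<le> l div q" using \<open>4 \<le> q\<close> by (intro zdiv_mono1; simp)+
      ultimately have "(l - 4) div q = l div q \<or> (l - 4) div q = l div q - 1"
        "(l - 4) div q \<le> (l - 2) div q" "(l - 2) div q \<le> l div q" by linarith+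
      moreover from this par(2) have "(l - 4) div q = l div q" by auto
      ultimately have "(l - 2) div q = l div q" by linarith
      with par(1) show False by simp
    qed
  qed (use assms in auto)
qed

end

section \<open>Powers of two in the weights and the final case distinction\<close>

lemma pow2_dvd_odd_mult_iff:
  fixes p :: nat
  assumes "odd p"
  shows "2 ^ k dvd p * 2 ^ r \<longleftrightarrow> k \<le> r"
proof
  assume dvd: "2 ^ k dvd p * 2 ^ r"
  show "k \<le> r"
  proof (rule ccontr)
    assume "\<not> k \<le> r"
    then have "2 * 2 ^ r dvd (2::nat) ^ k" using le_imp_power_dvd[of "Suc r" k "2::nat"] by simp
    then have "2 * 2 ^ r dvd p * 2 ^ r" using dvd dvd_trans by blast
    then show False using assms by simp
  qed
qed (simp add: le_imp_power_dvd)

theorem theorem11: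
  fixes d a1 a2 t1 t2 p1 p2 r1 r2 :: nat
    and V1 V2 :: "nat set"
    and K1 K2 S :: "nat set set"
  assumes "1 \<le> d"
    and "S \<subseteq> cube_verts d"
    and "S = K1 \<union> K2"
    and "is_cube_clique a1 (a1 + t1) V1 K1"
    and "is_cube_clique a2 (a2 + t2) V2 K2"
    and "V1 \<inter> V2 = {}"
    and "a1 = p1 * 2 ^ r1" and "odd p1"
    and "a2 = p2 * 2 ^ r2" and "odd p2"
    and "r1 \<le> r2"
  shows "cube_ramsey 2 d S \<longleftrightarrow>
           r1 = r2 \<or>
           ((t1 = 0 \<or> t2 = 0) \<and> even a1 \<and> even a2) \<or>
           ((t1 = 1 \<or> t2 = 1) \<and> 2 \<le> r1 \<and> r1 < r2)"
proof -
  have pos: "0 < a1" "0 < a2" using assms by (auto intro!: Nat.gr0I)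
  have V: "finite V1" "finite V2" "card V1 = a1 + t1" "card V2 = a2 + t2"
    and S: "S = nsets V1 a1 \<union> nsets V2 a2"
    using assms by (auto simp: is_cube_clique_def)
  \<comment> \<open>Only members of the cliques are known to lie in the cube; since the weight is
    positive, every vertex of \<open>W\<close> belongs to some member.\<close>
  have cover: "W \<subseteq> {1..d}" if W: "finite W" "a \<le> card W" "0 < a" "nsets W a \<subseteq> S" for W a
  proof
    fix x assume "x \<in> W"
    have "a - 1 \<le> card (W - {x})" using W \<open>x \<in> W\<close> by simp
    then obtain B where B: "B \<subseteq> W - {x}" "card B = a - 1" by (metis obtain_subset_with_card_n)
    have "finite B" using B W finite_subset by blast
    then have "card (insert x B) = a" using B W by (subst card_insert_disjoint) auto
    then have "insert x B \<in> nsets W a" using B \<open>x \<in> W\<close> \<open>finite B\<close> by (auto simp: nsets_def)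
    then show "x \<in> {1..d}" using W assms(2) by (auto simp: cube_verts_def)
  qed
  interpret clique_pair d a1 t1 V1 a2 t2 V2
    using assms(1,6) V pos cover[of V1 a1] cover[of V2 a2] S by unfold_locales auto
  interpret sw: clique_pair d a2 t2 V2 a1 t1 V1 by (rule swap)
  have sw: "nsets V2 a2 \<union> nsets V1 a1 = nsets V1 a1 \<union> nsets V2 a2" by blast
  have val: "2 ^ k dvd a1 \<longleftrightarrow> k \<le> r1" "2 ^ k dvd a2 \<longleftrightarrow> k \<le> r2" for k
    using assms pow2_dvd_odd_mult_iff by blast+
  have even: "even a1 \<longleftrightarrow> 1 \<le> r1" "even a2 \<longleftrightarrow> 1 \<le> r2"
    using val[of 1] by simp_all
  have four: "4 dvd a1 \<longleftrightarrow> 2 \<le> r1" "4 dvd a2 \<longleftrightarrow> 2 \<le> r2"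
    using val[of 2] by simp_all
  \<comment> \<open>The second, fourth and sixth cases are exactly those in which all three
    conditions fail. In the third and fifth, \<open>sw\<close> covers the possibility that the
    condition holds for \<open>t2\<close>.\<close>
  consider "r1 = r2" | "r1 < r2" "r1 = 0" | "r1 < r2" "1 \<le> r1" "t1 = 0 \<or> t2 = 0"
    | "r1 < r2" "r1 = 1" "1 \<le> t1" "1 \<le> t2"
    | "r1 < r2" "2 \<le> r1" "t1 = 1 \<or> t2 = 1"
    | "r1 < r2" "2 \<le> r1" "2 \<le> t1" "2 \<le> t2"
    using \<open>r1 \<le> r2\<close> by linarith
  then show ?thesis
  proof cases
    case 1
    then have "p2 * a1 = p1 * a2" using assms(7,9) by simp
    with 1 show ?thesis
      using ramsey_same_valuation[OF assms(8,10)] S by simp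
  next
    case 2
    then show ?thesis using not_ramsey_odd_even S even by simp
  next
    case 3
    then have "cube_ramsey 2 d S"
      using ramsey_no_slack sw.ramsey_no_slack even unfolding S sw by auto
    with 3 show ?thesis using even by simp
  next
    case 4
    then have "a1 mod 4 = 2" using assms(7,8) by simp presburger
    then show ?thesis using 4 not_ramsey_two_mod_four S four even by simp
  next
    case 5
    then have "cube_ramsey 2 d S"
      using ramsey_slack_one sw.ramsey_slack_one four unfolding S sw by auto
    with 5 show ?thesis by simp
  next
    case 6
    then have "2 ^ Suc r1 dvd a2" using val(2)[of "Suc r1"] by simp
    then show ?thesis using 6 not_ramsey_slack_two[OF _ _ _ assms(7,8)] S by simp
  qed
qed

end
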